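(* Let $d\ge 1$ be an integer, let $G$ be a (finite, simple) $d$-regular graph on a vertex set of size $N\geq 1$, let $\ell$ be an integer with $0\le \ell\le N/2$, and set $\alpha=2\ell/N$. Let $\Phi_\ell(G)$ denote the number of matchings of size $\ell$ in $G$. Then \[ \log \Phi_\ell(G) \leq \frac{N}{2}\left[\alpha \log d + 2 H(\alpha) + \alpha \log \frac{\alpha}{e} + \frac{\log d}{d-1}\right]. \]
   Context: Here $\log=\log_2$, $e$ is the base of natural logarithms, and $H$ is the binary entropy function $H(p)=-p\log p-(1-p)\log(1-p)$ for $p\in[0,1]$. Expressions of the form $0\cdot\log b$ (including $0\cdot\log 0$) are interpreted as $0$. The expression $\frac{\log x}{x-1}$ is interpreted as $\log e$ when $x=1$. If $\Phi_\ell(G)=0$, then $\log\Phi_\ell(G)$ is read as $-\infty$ and the inequality holds trivially. A matching of size $\ell$ is a set of $\ell$ pairwise disjoint edges. *)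

theory Defs
  imports Complex_Main "HOL-Library.Extended_Real"
begin

definition simple_graph :: "'a set \<Rightarrow> 'a set set \<Rightarrow> bool" where
  "simple_graph V E \<longleftrightarrow> finite V \<and> (\<forall>e\<in>E. e \<subseteq> V \<and> card e = 2)"

definition degree :: "'a set set \<Rightarrow> 'a \<Rightarrow> nat" where
  "degree E v = card {e \<in> E. v \<in> e}"

definition regular_graph :: "nat \<Rightarrow> 'a set \<Rightarrow> 'a set set \<Rightarrow> bool" where
  "regular_graph d V E \<longleftrightarrow> simple_graph V E \<and> (\<forall>v\<in>V. degree E v = d)"

definition is_matching :: "'a set set \<Rightarrow> 'a set set \<Rightarrow> bool" where
  "is_matching E M \<longleftrightarrow> M \<subseteq> E \<and> pairwise disjnt M"

definition num_matchings :: "nat \<Rightarrow> 'a set set \<Rightarrow> nat" where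
  "num_matchings l E = card {M. is_matching E M \<and> card M = l}"

text \<open>Binary logarithm of a count, with value \<open>-\<infinity>\<close> at 0 (the real-valued
  \<^const>\<open>log\<close> gives 0 there).\<close>

definition log2_count :: "nat \<Rightarrow> ereal" where
  "log2_count n = (if n = 0 then -\<infinity> else ereal (log 2 (real n)))"

text \<open>The convention \<open>0 * log b = 0\<close> is automatic, since \<^const>\<open>log\<close> is total.\<close>

definition binary_entropy :: "real \<Rightarrow> real" where
  "binary_entropy p = - p * log 2 p - (1 - p) * log 2 (1 - p)"

text \<open>\<open>log x / (x - 1)\<close>, extended continuously to \<open>x = 1\<close>.\<close>

definition log_ratio :: "real \<Rightarrow> real" where
  "log_ratio x = (if x = 1 then log 2 (exp 1) else log 2 x / (x - 1))"

end

theory Submission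
  imports Defs "HOL-Analysis.Harmonic_Numbers"
begin

text \<open>
  This is Radhakrishnan's entropy proof of Bregman's theorem, adapted to matchings of a fixed size
  in a graph that need not be bipartite. Give every uncovered vertex a dummy partner and
  reveal the edges and the uncovered vertices in random order, each time letting a random hidden
  vertex (or dummy) guess its partner among the hidden ones. When a vertex guesses, any vertex
  other than its partner is still hidden with a probability that depends only on the stage, so regularity fixes the
  expected number of candidates and Jensen's inequality bounds the expected code length by
  \<open>l J(x) + m J(N)\<close>, where \<open>m = N - 2l\<close>, \<open>x = d / \<alpha>\<close> and
  \<open>J(y) = \<integral>\<^sub>0\<^sup>1 ln (1 + (y - 1) t) dt = ln y - 1 + ln y / (y - 1)\<close>. The dummies contribute
  \<open>m!\<close> to the count, and dividing by it gives the bound, since \<open>ln y / (y - 1)\<close> is decreasing.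
\<close>

subsection \<open>Estimates for logarithms and factorials\<close>

text \<open>This is the integral of 1 / (1 + (x - 1) t) over t in [0, 1]; the value at x = 1 is the
  limit.\<close>

definition ln_ratio :: "real \<Rightarrow> real" where
  "ln_ratio x = (if x = 1 then 1 else ln x / (x - 1))"

lemma log_ratio_eq: "log_ratio x = ln_ratio x / ln 2"
  by (simp add: log_ratio_def ln_ratio_def log_def)

lemma ln_ratio_le_1: "x \<ge> 1 \<Longrightarrow> ln_ratio x \<le> 1"
  using ln_le_minus_one[of x] by (simp add: ln_ratio_def divide_simps)

lemma ln_ratio_nonneg: "x \<ge> 1 \<Longrightarrow> ln_ratio x \<ge> 0"
  by (simp add: ln_ratio_def)

lemma ln_ratio_mult: "x \<ge> 1 \<Longrightarrow> ln_ratio x * (x - 1) = ln x"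
  by (simp add: ln_ratio_def)

text \<open>For x > 1 the ratio is the slope of the chord of \<open>ln\<close> from 1 to x, and
  \<open>ln\<close> is concave.\<close>

lemma ln_ratio_antimono:
  assumes "1 \<le> x" "x \<le> y"
  shows "ln_ratio y \<le> ln_ratio x"
proof (cases "x = 1")
  case True
  then show ?thesis
    using ln_ratio_le_1[of y] assms by (simp add: ln_ratio_def)
next
  case False
  then have x: "1 < x" "1 < y" using assms by auto
  define t where "t = (x - 1) / (y - 1)"
  have t: "0 \<le> t" "t \<le> 1" and xt: "t * (y - 1) = x - 1"
    using x assms by (auto simp: t_def)
  have "(1 - t) * ln 1 + t * ln y \<le> ln ((1 - t) *\<^sub>R 1 + t *\<^sub>R y)"
    using concave_onD[OF ln_concave t, of 1 y] x by simp
  then have "t * ln y \<le> ln x" using xt by (simp add: algebra_simps)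
  then have "ln y * (x - 1) \<le> ln x * (y - 1)"
    using x by (simp add: t_def field_simps)
  then show ?thesis using x by (simp add: ln_ratio_def field_simps)
qed

text \<open>Since \<open>ln\<close> is concave, the trapezoid rule underestimates its integral, and
  \<open>x * ln x - x\<close> is an antiderivative.\<close>

lemma trapezoid_le_antideriv_ln:
  fixes a b :: real
  assumes "0 < a" "a \<le> b"
  shows "(ln a + ln b) / 2 * (b - a) \<le> (b * ln b - b) - (a * ln a - a)"
proof (cases "a = b")
  case False
  with assms have "2 * (b - a) / (a + b) \<le> ln b - ln a"
    using ln_inverse_approx_ge[of a b] by simp
  then have "2 * (b - a) \<le> (ln b - ln a) * (a + b)"
    using assms by (simp add: field_simps)
  then show ?thesis by (simp add: field_simps)
qed simp

lemma sum_trapezoid: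
  fixes f :: "nat \<Rightarrow> real"
  shows "(\<Sum>k<n. (f k + f (Suc k)) / 2) = (\<Sum>k<Suc n. f k) - (f 0 + f n) / 2"
  by (induction n) (auto simp: field_simps)

text \<open>The left side samples \<open>ln (1 + (y - 1) * t)\<close> at n equally spaced points of
  [0, 1], endpoints included; the right side is n times the integral. The trapezoid rule with n - 1
  panels covers all but half of the endpoint values, and that half, \<open>ln y / 2\<close>, is at
  most one more integral by the one-panel rule.\<close>

lemma sum_ln_equispaced_le:
  fixes y :: real
  assumes "1 \<le> y" "n \<ge> 1"
  shows "(\<Sum>k<n. ln (1 + real k / real (n - 1) * (y - 1))) \<le> real n * (ln y - 1 + ln_ratio y)"
proof (cases "y = 1")
  case True
  then show ?thesis by (simp add: ln_ratio_def)
next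
  case False
  then have y: "1 < y" using assms by simp
  define J where "J = ln y - 1 + ln_ratio y"
  have J: "J * (y - 1) = y * ln y - y + 1"
    using y ln_ratio_mult[of y] by (simp add: J_def algebra_simps)
  have "2 * (y - 1) \<le> ln y * (1 + y)"
    using ln_inverse_approx_ge[of 1 y] y by (simp add: field_simps)
  then have "ln y / 2 * (y - 1) \<le> J * (y - 1)"
    using J by (simp add: field_simps)
  then have J_ge: "ln y / 2 \<le> J" using y by simp
  show ?thesis
  proof (cases "n = 1")
    case True
    \<comment> \<open>With a single sample the point is 0 / 0 = 0, so the sum is
      \<open>ln 1 = 0\<close>.\<close>
    have "0 \<le> J" using J_ge y by (smt (verit) ln_gt_zero divide_pos_pos)
    then show ?thesis using True by (simp add: J_def)
  next
    case False
    define q where "q = n - 1"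
    have q: "n = Suc q" "q \<ge> 1" using False assms by (auto simp: q_def)
    define z where "z k = 1 + real k / real q * (y - 1)" for k
    define h where "h = (y - 1) / real q"
    have h: "h > 0" using y q by (simp add: h_def)
    have zdiff: "z (Suc k) - z k = h" for k
      by (simp add: z_def h_def field_simps add_divide_distrib)
    have z1: "z k \<ge> 1" for k using y by (simp add: z_def)
    have "(\<Sum>k<q. (ln (z k) + ln (z (Suc k))) / 2) * h
        \<le> (\<Sum>k<q. (z (Suc k) * ln (z (Suc k)) - z (Suc k)) - (z k * ln (z k) - z k))"
      unfolding sum_distrib_right
    proof (rule sum_mono)
      fix k
      show "(ln (z k) + ln (z (Suc k))) / 2 * h
        \<le> (z (Suc k) * ln (z (Suc k)) - z (Suc k)) - (z k * ln (z k) - z k)"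
        using trapezoid_le_antideriv_ln[of "z k" "z (Suc k)"] zdiff[of k] z1[of k] h by simp
    qed
    also have "\<dots> = (z q * ln (z q) - z q) - (z 0 * ln (z 0) - z 0)"
      by (rule sum_lessThan_telescope)
    also have "\<dots> = J * (y - 1)" using q J by (simp add: z_def)
    also have "\<dots> = real q * J * h" using q by (simp add: h_def)
    finally have "(\<Sum>k<q. (ln (z k) + ln (z (Suc k))) / 2) \<le> real q * J" using h by simp
    then have "(\<Sum>k<Suc q. ln (z k)) \<le> real q * J + ln y / 2"
      using q by (simp add: sum_trapezoid[of "\<lambda>k. ln (z k)"]) (simp add: z_def)
    also have "\<dots> \<le> real (Suc q) * J" using J_ge by (simp add: algebra_simps)
    finally show ?thesis using q by (simp add: z_def J_def)
  qed
qed

text \<open>A Stirling-type bound. Estimating ln (1 + 1 / m) by the trapezoid rule for 1 / x costs 1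
  / (4 m (m + 1)) per step. The extra term 1 / (2 m) drops by 1 / (2 m (m + 1)) per step and so
  absorbs this error in the induction.\<close>

lemma ln_fact_lower_aux:
  assumes "m \<ge> 1"
  shows "(real m + 1/2) * ln (real m) - real m + 1/2 + 1 / (2 * real m) \<le> ln (fact m)"
  using assms
proof (induction m rule: dec_induct)
  case base
  then show ?case by simp
next
  case (step m)
  then have m: "real m \<ge> 1" by simp
  have "ln (real m + 1) - ln (real m) \<le> 1 * (inverse (real m) + inverse (real m + 1)) / 2"
    using m ln_inverse_approx_le[of "real m" 1] by simp
  then have "(real m + 1/2) * (ln (real m + 1) - ln (real m))
      \<le> (real m + 1/2) * ((inverse (real m) + inverse (real m + 1)) / 2)"
    by (intro mult_left_mono) auto
  also have "\<dots> = 1 + 1 / (4 * real m * (real m + 1))"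
    using m by (simp add: divide_simps) (simp add: algebra_simps)
  also have "\<dots> \<le> 1 + 1 / (2 * real m * (real m + 1))"
    using m by (intro add_left_mono frac_le mult_right_mono mult_pos_pos) auto
  also have "\<dots> = 1 + 1 / (2 * real m) - 1 / (2 * (real m + 1))"
    using m by (simp add: divide_simps) (simp add: algebra_simps)
  finally have "(real m + 1/2) * (ln (real m + 1) - ln (real m)) \<le> 1 + 1 / (2 * real m) - 1 / (2 * (real m + 1))" .
  moreover have "ln (fact (Suc m) :: real) = ln (real m + 1) + ln (fact m)"
    by (simp add: ln_mult add.commute)
  ultimately show ?case using step.IH by (simp add: algebra_simps)
qed

lemma ln_fact_lower:
  assumes "m \<ge> 1"
  shows "(real m + 1/2) * ln (real m) - real m + 1/2 \<le> ln (fact m)"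
proof -
  have "0 \<le> 1 / (2 * real m)" by simp
  with ln_fact_lower_aux[OF assms] show ?thesis by linarith
qed

text \<open>One copy of \<open>ln_ratio N\<close> is at most 1; monotonicity compares the other m -
  1 copies with \<open>ln_ratio m * (m - 1) = ln m\<close>. The right side is twice the surplus of
  \<open>ln_fact_lower\<close> over \<open>m * ln m - m\<close>.\<close>

lemma mult_ln_ratio_le:
  assumes "1 \<le> m" "m \<le> N"
  shows "m * ln_ratio N \<le> 1 + ln m"
proof -
  have "(m - 1) * ln_ratio N \<le> (m - 1) * ln_ratio m"
    using assms by (intro mult_left_mono ln_ratio_antimono) auto
  then show ?thesis
    using ln_ratio_mult[of m] ln_ratio_le_1[of N] assms by (simp add: algebra_simps)
qed

subsection \<open>Averages over subsets of a given size\<close>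

definition subset_avg :: "nat \<Rightarrow> 'b set \<Rightarrow> ('b set \<Rightarrow> real) \<Rightarrow> real" where
  "subset_avg n P c = (\<Sum>Q | Q \<subseteq> P \<and> card Q = n. c Q) / real (card P choose n)"

lemma finite_subsets_card [simp]: "finite P \<Longrightarrow> finite {Q. Q \<subseteq> P \<and> card Q = n}"
  by (rule finite_subset[of _ "Pow P"]) auto

lemma subset_avg_0 [simp]: "finite P \<Longrightarrow> subset_avg 0 P c = c {}"
proof -
  assume "finite P"
  then have "{Q. Q \<subseteq> P \<and> card Q = 0} = {{}}"
    by (auto dest: finite_subset)
  then show ?thesis by (simp add: subset_avg_def)
qed

lemma subset_avg_card [simp]: "finite P \<Longrightarrow> subset_avg (card P) P c = c P"
proof -
  assume "finite P"
  then have "{Q. Q \<subseteq> P \<and> card Q = card P} = {P}"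
    by (auto dest: card_subset_eq)
  then show ?thesis by (simp add: subset_avg_def)
qed

lemma subset_avg_const: "finite P \<Longrightarrow> n \<le> card P \<Longrightarrow> subset_avg n P (\<lambda>_. a) = a"
  by (simp add: subset_avg_def n_subsets)

lemma subset_avg_add: "subset_avg n P (\<lambda>Q. f Q + g Q) = subset_avg n P f + subset_avg n P g"
  by (simp add: subset_avg_def sum.distrib add_divide_distrib)

lemma subset_avg_cong:
  "(\<And>Q. Q \<subseteq> P \<Longrightarrow> card Q = n \<Longrightarrow> f Q = g Q) \<Longrightarrow> subset_avg n P f = subset_avg n P g"
  unfolding subset_avg_def by (intro arg_cong2[where f="(/)"] sum.cong) auto

lemma subset_avg_divide: "subset_avg n P (\<lambda>Q. f Q / a) = subset_avg n P f / a"
  by (simp add: subset_avg_def sum_divide_distrib[symmetric] divide_divide_eq_left mult.commute)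

lemma subset_avg_sum:
  "subset_avg n P (\<lambda>Q. \<Sum>x\<in>A. f x Q) = (\<Sum>x\<in>A. subset_avg n P (f x))"
  unfolding subset_avg_def sum_divide_distrib[symmetric] by (subst sum.swap) simp

text \<open>Both sides enumerate pairs of an n-subset and a member of it, choosing the subset first
  or the member first. The factor n / card P is the probability that a given block lies in the
  subset.\<close>

lemma subset_avg_swap:
  assumes "finite P" "1 \<le> n" "n \<le> card P"
  shows "subset_avg n P (\<lambda>Q. \<Sum>B\<in>Q. k B Q)
    = real n / real (card P) * (\<Sum>B\<in>P. subset_avg (n - 1) (P - {B}) (\<lambda>Q. k B (insert B Q)))"
proof -
  have fin: "finite Q" if "Q \<subseteq> P" for Q using that assms(1) finite_subset by blast
  have "(\<Sum>Q | Q \<subseteq> P \<and> card Q = n. \<Sum>B\<in>Q. k B Q)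
      = (\<Sum>(Q, B)\<in>(SIGMA Q:{Q. Q \<subseteq> P \<and> card Q = n}. Q). k B Q)"
    using assms(1) fin by (intro sum.Sigma) auto
  also have "\<dots> = (\<Sum>(B, Q)\<in>(SIGMA B:P. {Q. Q \<subseteq> P - {B} \<and> card Q = n - 1}). k B (insert B Q))"
  proof (rule sum.reindex_bij_witness[where i="\<lambda>(B, Q). (insert B Q, B)" and j="\<lambda>(Q, B). (B, Q - {B})"], goal_cases)
    case (4 x)
    then obtain B Q where x: "x = (B, Q)" "B \<in> P" "Q \<subseteq> P - {B}" "card Q = n - 1" by auto
    then have "finite Q" "B \<notin> Q" using fin by blast+
    then show ?case using x assms by (auto simp: card_insert_if)
  qed (auto simp: insert_absorb)
  also have "\<dots> = (\<Sum>B\<in>P. \<Sum>Q | Q \<subseteq> P - {B} \<and> card Q = n - 1. k B (insert B Q))"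
    using assms(1) by (intro sum.Sigma[symmetric]) auto
  finally have *: "(\<Sum>Q | Q \<subseteq> P \<and> card Q = n. \<Sum>B\<in>Q. k B Q)
      = (\<Sum>B\<in>P. \<Sum>Q | Q \<subseteq> P - {B} \<and> card Q = n - 1. k B (insert B Q))" .
  have "n * (card P choose n) = card P * ((card P - 1) choose (n - 1))"
    using assms by (intro times_binomial_minus1_eq) auto
  then have "real n * real (card P choose n) = real (card P) * real ((card P - 1) choose (n - 1))"
    by (metis of_nat_mult)
  moreover have "0 < real (card P choose n)" "0 < real ((card P - 1) choose (n - 1))" "0 < real (card P)"
    using assms by auto
  ultimately have "1 / real (card P choose n)
      = real n / real (card P) * (1 / real ((card P - 1) choose (n - 1)))"
    by (simp add: field_simps)
  then have scale: "x / real (card P choose n)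
      = real n / real (card P) * (x / real ((card P - 1) choose (n - 1)))" for x
    by (metis (no_types) mult.commute mult.left_commute mult_1 times_divide_eq_right)
  have "subset_avg n P (\<lambda>Q. \<Sum>B\<in>Q. k B Q) = real n / real (card P) *
     ((\<Sum>B\<in>P. \<Sum>Q | Q \<subseteq> P - {B} \<and> card Q = n - 1. k B (insert B Q)) / real ((card P - 1) choose (n - 1)))"
    unfolding subset_avg_def * by (rule scale)
  also have "(\<Sum>B\<in>P. \<Sum>Q | Q \<subseteq> P - {B} \<and> card Q = n - 1. k B (insert B Q)) / real ((card P - 1) choose (n - 1))
     = (\<Sum>B\<in>P. subset_avg (n - 1) (P - {B}) (\<lambda>Q. k B (insert B Q)))"
    by (simp add: subset_avg_def assms(1) sum_divide_distrib)
  finally show ?thesis .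
qed

text \<open>A uniform n-subset also arises by deleting a uniform element and drawing from the rest:
  each Q is counted once for each of the \<open>card P - n\<close> elements outside it.\<close>

lemma subset_avg_delete:
  assumes "finite P" "n < card P"
  shows "subset_avg n P c = (\<Sum>B\<in>P. subset_avg n (P - {B}) c) / real (card P)"
proof -
  have fin: "finite Q" if "Q \<subseteq> P" for Q using that assms(1) finite_subset by blast
  have "(\<Sum>B\<in>P. \<Sum>Q | Q \<subseteq> P - {B} \<and> card Q = n. c Q)
      = (\<Sum>(B, Q)\<in>(SIGMA B:P. {Q. Q \<subseteq> P - {B} \<and> card Q = n}). c Q)"
    using assms(1) by (intro sum.Sigma) auto
  also have "\<dots> = (\<Sum>(Q, B)\<in>(SIGMA Q:{Q. Q \<subseteq> P \<and> card Q = n}. P - Q). c Q)"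
    by (rule sum.reindex_bij_witness[where i="\<lambda>(Q, B). (B, Q)" and j="\<lambda>(B, Q). (Q, B)"]) auto
  also have "\<dots> = (\<Sum>Q | Q \<subseteq> P \<and> card Q = n. \<Sum>B\<in>P - Q. c Q)"
    using assms(1) by (intro sum.Sigma[symmetric]) auto
  also have "\<dots> = (\<Sum>Q | Q \<subseteq> P \<and> card Q = n. real (card P - n) * c Q)"
    using assms fin by (intro sum.cong) (auto simp: card_Diff_subset)
  finally have *: "(\<Sum>B\<in>P. \<Sum>Q | Q \<subseteq> P - {B} \<and> card Q = n. c Q)
      = real (card P - n) * (\<Sum>Q | Q \<subseteq> P \<and> card Q = n. c Q)"
    by (simp add: sum_distrib_left)
  have "(card P - n) * (card P choose n) = card P * ((card P - 1) choose n)"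
    by (rule binomial_absorb_comp)
  then have bin: "real (card P - n) * real (card P choose n) = real (card P) * real ((card P - 1) choose n)"
    by (metis of_nat_mult)
  have pos: "0 < real (card P choose n)" "0 < real ((card P - 1) choose n)" "0 < real (card P)"
    using assms by auto
  have scale: "real (card P - n) * x / real ((card P - 1) choose n) = real (card P) * (x / real (card P choose n))" for x
  proof -
    have "(real (card P - n) * x) * real (card P choose n) = (real (card P) * x) * real ((card P - 1) choose n)"
      using bin by (metis mult.assoc mult.commute)
    with pos show ?thesis by (simp add: frac_eq_eq)
  qed
  have "(\<Sum>B\<in>P. subset_avg n (P - {B}) c)
     = (\<Sum>B\<in>P. \<Sum>Q | Q \<subseteq> P - {B} \<and> card Q = n. c Q) / real ((card P - 1) choose n)"
    by (simp add: subset_avg_def assms(1) sum_divide_distrib)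
  also have "\<dots> = real (card P) * subset_avg n P c"
    unfolding * subset_avg_def using scale by simp
  finally show ?thesis using pos by simp
qed

lemma subset_avg_linear:
  assumes "finite P" "n \<le> card P"
  shows "subset_avg n P (\<lambda>Q. a + (\<Sum>B\<in>Q. f B)) = a + real n / real (card P) * (\<Sum>B\<in>P. f B)"
proof (cases "n = 0")
  case True
  then show ?thesis using assms by simp
next
  case False
  have "(\<Sum>B\<in>P. subset_avg (n - 1) (P - {B}) (\<lambda>Q. f B)) = (\<Sum>B\<in>P. f B)"
    using assms by (intro sum.cong refl subset_avg_const) auto
  then show ?thesis
    using assms False subset_avg_swap[of P n "\<lambda>B Q. f B"]
    by (simp add: subset_avg_add subset_avg_const)
qed

lemma subset_avg_ln_le:
  assumes "finite P" "n \<le> card P" "\<And>Q. Q \<subseteq> P \<Longrightarrow> 0 < f Q"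
  shows "subset_avg n P (\<lambda>Q. ln (f Q)) \<le> ln (subset_avg n P f)"
proof -
  let ?S = "{Q. Q \<subseteq> P \<and> card Q = n}"
  have c: "card ?S = card P choose n" using assms n_subsets by blast
  have pos: "0 < card ?S" using assms c by simp
  have ne: "?S \<noteq> {}" using pos by (metis card.empty less_irrefl)
  have "(\<Sum>Q\<in>?S. (1 / real (card ?S)) * ln (f Q)) \<le> ln (\<Sum>Q\<in>?S. (1 / real (card ?S)) *\<^sub>R f Q)"
    using pos ne assms by (intro concave_on_sum[OF _ _ ln_concave]) auto
  then show ?thesis by (simp add: subset_avg_def c sum_divide_distrib)
qed

text \<open>Jensen's inequality for \<open>ln\<close>, then linearity: each B lies in Q with
  probability n / card P. The constant a will be the weight of the block being asked, which is
  always hidden.\<close>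

lemma subset_avg_ln_sum_le:
  assumes "finite P" "n \<le> card P" "0 < a" "\<And>B. B \<in> P \<Longrightarrow> 0 \<le> f B"
  shows "subset_avg n P (\<lambda>Q. ln (a + (\<Sum>B\<in>Q. f B)))
    \<le> ln (a + real n / real (card P) * (\<Sum>B\<in>P. f B))"
  using subset_avg_ln_le[OF assms(1,2), of "\<lambda>Q. a + (\<Sum>B\<in>Q. f B)"] assms(3,4)
  by (simp add: subset_avg_linear[OF assms(1,2)] add_pos_nonneg sum_nonneg subset_iff)

subsection \<open>Revealing a matching in random order\<close>

text \<open>
  A matching of \<open>S\<close> leaving \<open>i\<close> vertices uncovered is encoded as the partition of \<open>S\<close>
  (an element of \<open>configs E S i\<close>) into the matching edges and the uncovered singletons. It is
  revealed block by block. If \<open>Q\<close> is the set of blocks still hidden, one of \<open>2 * card Q\<close> askers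
  is chosen uniformly: a vertex \<open>v\<close> of \<open>\<Union>Q\<close>, which guesses its hidden neighbour (weight 1 each)
  or one of the dummy partners of the uncovered vertices (weight \<open>w\<close> each), so that
  \<open>\<Sum>B\<in>Q. avail E w v B\<close> is the total weight; or a dummy, which guesses a uniform vertex of
  \<open>\<Union>Q\<close>. Then \<open>ask_cost\<close> is the code length charged to a block over its two askers, and
  \<open>total_cost\<close> the expected code length of the whole partition.
\<close>

definition avail :: "'a set set \<Rightarrow> real \<Rightarrow> 'a \<Rightarrow> 'a set \<Rightarrow> real" where
  "avail E w v B = real (card {u\<in>B. {v, u} \<in> E}) + (if card B = 1 then w else 0)"

definition ask_cost :: "'a set set \<Rightarrow> real \<Rightarrow> 'a set set \<Rightarrow> 'a set \<Rightarrow> real" where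
  "ask_cost E w Q B = (\<Sum>v\<in>B. ln (\<Sum>B'\<in>Q. avail E w v B'))
     + (if card B = 1 then ln (\<Sum>B'\<in>Q. real (card B')) - ln w else 0)"

definition step_cost :: "'a set set \<Rightarrow> real \<Rightarrow> 'a set set \<Rightarrow> real" where
  "step_cost E w Q = (\<Sum>B\<in>Q. ask_cost E w Q B) / (2 * real (card Q))"

definition total_cost :: "'a set set \<Rightarrow> real \<Rightarrow> 'a set set \<Rightarrow> real" where
  "total_cost E w P = (\<Sum>n=1..card P. subset_avg n P (step_cost E w))"

definition configs :: "'a set set \<Rightarrow> 'a set \<Rightarrow> nat \<Rightarrow> 'a set set set" where
  "configs E S i = {P. \<Union>P = S \<and> pairwise disjnt P \<and> (\<forall>B\<in>P. B \<in> E \<or> card B = 1)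
     \<and> card {B\<in>P. card B = 1} = i}"

text \<open>The first revealed block B is uniform. The stage with everything hidden costs
  \<open>step_cost E w P\<close>, and the later stages form the same process on
  \<open>P - {B}\<close>.\<close>

lemma total_cost_rec:
  assumes "finite P" "P \<noteq> {}"
  shows "total_cost E w P
    = step_cost E w P + (\<Sum>B\<in>P. total_cost E w (P - {B})) / real (card P)"
proof -
  define p where "p = card P - 1"
  have p: "card P = Suc p" using assms by (simp add: p_def card_gt_0_iff Suc_pred')
  let ?c = "step_cost E w"
  have "(\<Sum>n=1..p. subset_avg n P ?c) = (\<Sum>n=1..p. \<Sum>B\<in>P. subset_avg n (P - {B}) ?c / real (card P))"
    using p assms(1) by (intro sum.cong refl) (simp add: subset_avg_delete sum_divide_distrib)
  also have "\<dots> = (\<Sum>B\<in>P. \<Sum>n=1..p. subset_avg n (P - {B}) ?c / real (card P))"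
    by (rule sum.swap)
  also have "\<dots> = (\<Sum>B\<in>P. total_cost E w (P - {B}) / real (card P))"
    using assms p by (intro sum.cong refl) (simp add: total_cost_def sum_divide_distrib)
  finally have "(\<Sum>n=1..p. subset_avg n P ?c) = (\<Sum>B\<in>P. total_cost E w (P - {B})) / real (card P)"
    by (simp add: sum_divide_distrib)
  moreover have "total_cost E w P = (\<Sum>n=1..p. subset_avg n P ?c) + subset_avg (card P) P ?c"
    unfolding total_cost_def p by simp
  ultimately show ?thesis using assms by simp
qed

section \<open>Partitions into edges and singletons\<close>

lemma finite_configs: "finite S \<Longrightarrow> finite (configs E S i)"
  by (rule finite_subset[of _ "Pow (Pow S)"]) (auto simp: configs_def)

lemma finite_mem_configs: "finite S \<Longrightarrow> P \<in> configs E S i \<Longrightarrow> finite P"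
  by (rule finite_UnionD) (simp add: configs_def)

lemma configs_block:
  assumes "P \<in> configs E S i" "B \<in> P" "\<And>e. e \<in> E \<Longrightarrow> card e = 2"
  shows "(card B = 1 \<or> (B \<in> E \<and> card B = 2)) \<and> B \<subseteq> S \<and> B \<noteq> {} \<and> finite B"
proof -
  have "card B = 1 \<or> (B \<in> E \<and> card B = 2)" "B \<subseteq> S"
    using assms unfolding configs_def by blast+
  moreover from this have "card B > 0" by auto
  ultimately show ?thesis by (auto simp: card_gt_0_iff)
qed

lemma configs_sum_inter:
  assumes "finite S" "P \<in> configs E S i"
  shows "(\<Sum>B\<in>P. real (card {u\<in>B. Q u})) = real (card {u\<in>S. Q u})"
proof -
  have P: "pairwise disjnt P" "\<Union>P = S" using assms by (auto simp: configs_def)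
  have fin: "finite P" using finite_mem_configs assms by blast
  have "card (\<Union>B\<in>P. {u\<in>B. Q u}) = (\<Sum>B\<in>P. card {u\<in>B. Q u})"
  proof (rule card_UN_disjoint)
    show "\<forall>B\<in>P. finite {u\<in>B. Q u}"
      using P(2) assms(1) by (auto intro: finite_subset)
    show "\<forall>B\<in>P. \<forall>B'\<in>P. B \<noteq> B' \<longrightarrow> {u\<in>B. Q u} \<inter> {u\<in>B'. Q u} = {}"
      using P(1) by (auto simp: pairwise_def disjnt_def)
  qed (fact fin)
  moreover have "(\<Union>B\<in>P. {u\<in>B. Q u}) = {u\<in>S. Q u}" using P by auto
  ultimately show ?thesis by simp
qed

lemma configs_sum_card:
  assumes "finite S" "P \<in> configs E S i"
  shows "(\<Sum>B\<in>P. real (card B)) = real (card S)"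
  using configs_sum_inter[OF assms, of "\<lambda>_. True"] by simp

text \<open>The total weight offered to v depends on S and i only, not on P. Hence the guess of v
  follows a distribution that is fixed before P is known.\<close>

lemma configs_sum_avail:
  assumes "finite S" "P \<in> configs E S i"
  shows "(\<Sum>B\<in>P. avail E w v B) = real (card {u\<in>S. {v, u} \<in> E}) + w * real i"
proof -
  have "(\<Sum>B\<in>P. if card B = 1 then w else 0) = (\<Sum>B\<in>{B\<in>P. card B = 1}. w)"
    using finite_mem_configs[OF assms] by (intro sum.inter_filter[symmetric])
  also have "\<dots> = w * real i"
    using assms by (simp add: configs_def)
  finally show ?thesis
    by (simp only: avail_def sum.distrib configs_sum_inter[OF assms])
qed

text \<open>Every block has two askers: an edge its two endpoints, a singleton its vertex and a
  dummy.\<close>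

lemma configs_card:
  assumes "finite S" "P \<in> configs E S i" "\<And>e. e \<in> E \<Longrightarrow> card e = 2"
  shows "card S + i = 2 * card P"
proof -
  have fin: "finite P" using finite_mem_configs assms by blast
  have "(\<Sum>B\<in>P. real (card B) + (if card B = 1 then 1 else 0)) = (\<Sum>B\<in>P. 2)"
  proof (rule sum.cong)
    fix B assume "B \<in> P"
    then have "card B = 1 \<or> card B = 2" using configs_block[OF assms(2) _ assms(3)] by blast
    then show "real (card B) + (if card B = 1 then 1 else 0) = 2" by auto
  qed simp
  moreover have "(\<Sum>B\<in>P. if card B = 1 then 1 else 0 :: real) = (\<Sum>B\<in>{B\<in>P. card B = 1}. 1)"
    using fin by (intro sum.inter_filter[symmetric])
  moreover have "(\<Sum>B\<in>{B\<in>P. card B = 1}. 1::real) = real i"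
    using assms by (simp add: configs_def)
  ultimately have "real (card S) + real i = 2 * real (card P)"
    using configs_sum_card[OF assms(1,2)] by (simp only: sum.distrib sum_constant)
  then show ?thesis by linarith
qed

lemma configs_Diff:
  assumes "finite S" "P \<in> configs E S i" "B \<in> P" "\<And>e. e \<in> E \<Longrightarrow> card e = 2"
  shows "card B = 1 \<Longrightarrow> i > 0 \<and> P - {B} \<in> configs E (S - B) (i - 1)"
    and "card B \<noteq> 1 \<Longrightarrow> P - {B} \<in> configs E (S - B) i"
proof -
  have fin: "finite P" using finite_mem_configs assms by blast
  have P: "\<Union>P = S" "pairwise disjnt P" "\<forall>B\<in>P. B \<in> E \<or> card B = 1" "card {B\<in>P. card B = 1} = i"
    using assms(2) by (auto simp: configs_def)
  have U: "\<Union>(P - {B}) = S - B"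
    using P(1,2) assms(3) by (auto simp: pairwise_def disjnt_def)
  have D: "pairwise disjnt (P - {B})" using P(2) by (rule pairwise_subset) auto
  show "i > 0 \<and> P - {B} \<in> configs E (S - B) (i - 1)" if "card B = 1"
  proof -
    have "{B'\<in>P - {B}. card B' = 1} = {B'\<in>P. card B' = 1} - {B}" by auto
    moreover have "B \<in> {B'\<in>P. card B' = 1}" using assms that by simp
    moreover from this have "i > 0" using P(4) fin by (auto simp: card_gt_0_iff)
    ultimately show ?thesis using U D P by (simp add: configs_def)
  qed
  show "P - {B} \<in> configs E (S - B) i" if "card B \<noteq> 1"
  proof -
    have "{B'\<in>P - {B}. card B' = 1} = {B'\<in>P. card B' = 1}" using that by auto
    then show ?thesis using U D P by (simp add: configs_def)
  qed
qed

lemma finite_subset_Collect: "finite S \<Longrightarrow> finite {B. B \<in> E \<and> B \<subseteq> S}"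
  by (rule finite_subset[of _ "Pow S"]) auto

text \<open>Removing a block B leaves a configuration of \<open>S - B\<close>, and B together with
  the rest determines P. Injectivity of this map and \<open>0 \<le> h B P\<close> give the
  bound.\<close>

lemma sum_configs_blocks_le:
  fixes h :: "'a set \<Rightarrow> 'a set set \<Rightarrow> real"
  assumes "finite S" "\<And>e. e \<in> E \<Longrightarrow> card e = 2" "\<And>B P. 0 \<le> h B P"
  shows "(\<Sum>P\<in>configs E S i. \<Sum>B\<in>P. h B (P - {B}))
    \<le> (\<Sum>B | B \<in> E \<and> B \<subseteq> S. \<Sum>P\<in>configs E (S - B) i. h B P)
      + (\<Sum>v\<in>S. if i = 0 then 0 else \<Sum>P\<in>configs E (S - {v}) (i - 1). h {v} P)"
proof -
  define X where "X = (SIGMA P:configs E S i. P)"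
  define Y1 where "Y1 = (SIGMA B:{B. B \<in> E \<and> B \<subseteq> S}. configs E (S - B) i)"
  \<comment> \<open>For i = 0 no block is a singleton, while the truncated \<open>i - 1\<close>
    would still be 0; hence the empty index set.\<close>
  define Y2 where "Y2 = (SIGMA B:(if i = 0 then {} else (\<lambda>v. {v}) ` S). configs E (S - B) (i - 1))"
  define \<phi> where "\<phi> = (\<lambda>(P, B). (B, P - {B} :: 'a set set))"
  have finE: "finite {B. B \<in> E \<and> B \<subseteq> S}"
    by (rule finite_subset_Collect[OF assms(1)])
  have finC: "finite (configs E (S - B) j)" for B j
    by (rule finite_configs) (use assms(1) in simp)
  have finY: "finite Y1" "finite Y2"
    unfolding Y1_def Y2_def using finE finC assms(1) by (auto intro!: finite_SigmaI)
  have inj: "inj_on \<phi> X"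
  proof (rule inj_onI)
    fix x y assume "x \<in> X" "y \<in> X" and eq: "\<phi> x = \<phi> y"
    then obtain P B P' B' where xy: "x = (P, B)" "y = (P', B')" "B \<in> P" "B' \<in> P'"
      by (auto simp: X_def)
    with eq have "B = B'" "P - {B} = P' - {B}" by (auto simp: \<phi>_def)
    with xy show "x = y" by (metis insert_Diff)
  qed
  have img: "\<phi> ` X \<subseteq> Y1 \<union> Y2"
  proof
    fix y assume "y \<in> \<phi> ` X"
    then obtain P B where PB: "P \<in> configs E S i" "B \<in> P" and y: "y = (B, P - {B})"
      by (auto simp: X_def \<phi>_def)
    have B: "B \<subseteq> S" "card B = 1 \<or> B \<in> E \<and> card B = 2" using configs_block[OF PB assms(2)] by auto
    show "y \<in> Y1 \<union> Y2"
    proof (cases "card B = 1")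
      case True
      then obtain v where "B = {v}" by (auto simp: card_1_singleton_iff)
      then show ?thesis
        using configs_Diff(1)[OF assms(1) PB assms(2) True] B y by (auto simp: Y2_def)
    next
      case False
      then show ?thesis
        using configs_Diff(2)[OF assms(1) PB assms(2) False] B y by (auto simp: Y1_def)
    qed
  qed
  have "(\<Sum>P\<in>configs E S i. \<Sum>B\<in>P. h B (P - {B})) = (\<Sum>(P, B)\<in>X. h B (P - {B}))"
    unfolding X_def using finite_configs[OF assms(1)] finite_mem_configs[OF assms(1)]
    by (intro sum.Sigma) auto
  also have "\<dots> = (\<Sum>y\<in>\<phi> ` X. h (fst y) (snd y))"
    unfolding sum.reindex[OF inj] by (intro sum.cong) (auto simp: \<phi>_def)
  also have "\<dots> \<le> (\<Sum>y\<in>Y1 \<union> Y2. h (fst y) (snd y))"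
    using finY img assms(3) by (intro sum_mono2) auto
  also have "\<dots> \<le> (\<Sum>y\<in>Y1. h (fst y) (snd y)) + (\<Sum>y\<in>Y2. h (fst y) (snd y))"
    using finY assms(3) sum_nonneg[of "Y1 \<inter> Y2" "\<lambda>y. h (fst y) (snd y)"] by (simp add: sum_Un)
  also have "(\<Sum>y\<in>Y1. h (fst y) (snd y)) = (\<Sum>B | B \<in> E \<and> B \<subseteq> S. \<Sum>P\<in>configs E (S - B) i. h B P)"
    unfolding Y1_def using finE finC
    by (subst sum.Sigma) (auto simp: case_prod_beta)
  also have "(\<Sum>y\<in>Y2. h (fst y) (snd y))
     = (\<Sum>B\<in>(if i = 0 then {} else (\<lambda>v. {v}) ` S). \<Sum>P\<in>configs E (S - B) (i - 1). h B P)"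
    unfolding Y2_def using finC assms(1)
    by (subst sum.Sigma) (auto simp: case_prod_beta)
  also have "\<dots> = (\<Sum>v\<in>S. if i = 0 then 0 else \<Sum>P\<in>configs E (S - {v}) (i - 1). h {v} P)"
    by (cases "i = 0") (auto simp: sum.reindex)
  finally show ?thesis .
qed

section \<open>Kraft's inequality for configurations\<close>

lemma exp_mean_ln_le:
  fixes x y :: real
  assumes "0 < x" "0 < y"
  shows "exp (- (ln x + ln y) / 2) \<le> (1 / x + 1 / y) / 2"
proof -
  have "exp ((1 - 1/2) *\<^sub>R (- ln x) + (1/2) *\<^sub>R (- ln y)) \<le> (1 - 1/2) * exp (- ln x) + 1/2 * exp (- ln y)"
    by (rule convex_onD[OF exp_convex]) auto
  then show ?thesis using assms by (simp add: exp_minus field_simps)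
qed

lemma exp_avg_le:
  fixes y :: "'b \<Rightarrow> real"
  assumes "finite A" "A \<noteq> {}"
  shows "exp ((\<Sum>i\<in>A. y i) / real (card A)) \<le> (\<Sum>i\<in>A. exp (y i)) / real (card A)"
proof -
  have "exp (\<Sum>i\<in>A. (1 / real (card A)) *\<^sub>R y i) \<le> (\<Sum>i\<in>A. (1 / real (card A)) * exp (y i))"
    using assms by (intro convex_on_sum[OF _ _ exp_convex]) auto
  then show ?thesis by (simp add: sum_divide_distrib)
qed

lemma card_neighbours_eq:
  assumes "\<And>e. e \<in> E \<Longrightarrow> card e = 2" "v \<in> S"
  shows "card {u\<in>S. {v, u} \<in> E} = card {B. (B \<in> E \<and> B \<subseteq> S) \<and> v \<in> B}"
proof -
  have "bij_betw (\<lambda>u. {v, u}) {u\<in>S. {v, u} \<in> E} {B. (B \<in> E \<and> B \<subseteq> S) \<and> v \<in> B}"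
  proof (rule bij_betwI')
    fix B assume "B \<in> {B. (B \<in> E \<and> B \<subseteq> S) \<and> v \<in> B}"
    then have B: "B \<in> E" "B \<subseteq> S" "v \<in> B" "card B = 2" using assms(1) by auto
    from B(4) obtain a b where "B = {a, b}" unfolding card_2_iff by blast
    with B(3) have "B = {v, a} \<or> B = {v, b}" by blast
    then show "\<exists>u\<in>{u\<in>S. {v, u} \<in> E}. B = {v, u}" using B(1,2) by blast
  qed (use assms(2) in \<open>auto simp: doubleton_eq_iff\<close>)
  then show ?thesis by (rule bij_betw_same_card)
qed

text \<open>
  Up to the factor \<open>i!\<close> counting assignments of dummies, the guesses form a sub-probability
  distribution; convexity of \<open>exp\<close> allows averaging the code length over the askers.
\<close>

lemma kraft_configs:
  fixes E :: "'a set set" and S :: "'a set"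
  assumes "finite S" "\<And>e. e \<in> E \<Longrightarrow> card e = 2" "0 < w"
  shows "fact i * (\<Sum>P\<in>configs E S i. exp (- total_cost E w P)) \<le> 1"
  using assms(1)
proof (induction "card S" arbitrary: S i rule: less_induct)
  case less
  note finS = less.prems
  show ?case
  proof (cases "S = {}")
    case True
    have "P = {}" if "P \<in> configs E S i" for P
    proof -
      have "B \<notin> P" for B
        using configs_block[OF that _ assms(2), of B] True by auto
      then show ?thesis by auto
    qed
    then have sub: "configs E S i \<subseteq> {{}}" by blast
    show ?thesis
    proof (cases "configs E S i = {}")
      case False
      with sub have eq: "configs E S i = {{}}" by auto
      then have "{} \<in> configs E S i" by simp
      then have "i = 0" by (simp add: configs_def)
      with eq show ?thesis by (simp add: total_cost_def)
    qed simp
  next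
    case False
    have cS: "card S > 0" using False finS by (simp add: card_gt_0_iff)
    define D where "D v = real (card {u\<in>S. {v, u} \<in> E}) + w * real i" for v
    define M where "M = real (card S) + real i"
    have M: "M > 0" using cS by (simp add: M_def)
    define r where "r B = (\<Sum>v\<in>B. (if card B = 1 then w else 1) / D v)
        + (if card B = 1 then 1 / real (card S) else 0)" for B
    define h where "h B P = exp (- total_cost E w P) * r B" for B P
    have D0: "D v \<ge> 0" for v using assms(3) by (simp add: D_def)
    have r0: "r B \<ge> 0" for B
      unfolding r_def using D0 assms(3) by (intro add_nonneg_nonneg sum_nonneg) auto
    \<comment> \<open>By convexity, \<open>exp\<close> of minus the mean cost of the two askers is
      at most the mean of their success probabilities.\<close>
    have block: "exp (- ask_cost E w P B / 2) \<le> r B / 2"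
      if P: "P \<in> configs E S i" and B: "B \<in> P" for P B
    proof -
      have ask: "ask_cost E w P B = (\<Sum>v\<in>B. ln (D v)) + (if card B = 1 then ln (real (card S)) - ln w else 0)"
        unfolding ask_cost_def configs_sum_avail[OF finS P] configs_sum_card[OF finS P] D_def ..
      consider "card B = 1" | "card B = 2" "B \<in> E" "B \<subseteq> S"
        using configs_block[OF P B assms(2)] by blast
      then show ?thesis
      proof cases
        case 1
        then obtain v where v: "B = {v}" by (auto simp: card_1_singleton_iff)
        have "i > 0" using configs_Diff(1)[OF finS P B assms(2) 1] by simp
        then have Dv: "D v > 0" using assms(3) by (simp add: D_def add_nonneg_pos)
        \<comment> \<open>Regrouped so that the vertex pays \<open>ln (D v / w)\<close> and the
          dummy pays \<open>ln (card S)\<close>.\<close>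
        have "ask_cost E w P B = ln (D v / w) + ln (real (card S))"
          using ask v Dv assms(3) by (simp add: ln_div)
        then show ?thesis
          using exp_mean_ln_le[of "D v / w" "real (card S)"] Dv assms(3) cS v by (simp add: r_def)
      next
        case 2
        then obtain u v where uv: "B = {u, v}" "u \<noteq> v" by (auto simp: card_2_iff)
        have "u \<in> {x\<in>S. {v, x} \<in> E}" "v \<in> {x\<in>S. {u, x} \<in> E}" using 2 uv by (auto simp: insert_commute)
        then have "card {x\<in>S. {v, x} \<in> E} > 0" "card {x\<in>S. {u, x} \<in> E} > 0"
          using finS by (auto simp: card_gt_0_iff)
        then have "D u > 0" "D v > 0" using assms(3) by (simp_all add: D_def add_pos_nonneg)
        then show ?thesis
          using exp_mean_ln_le[of "D u" "D v"] ask uv 2 by (simp add: r_def)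
      qed
    qed
    \<comment> \<open>The recursion is unfolded, and Jensen's inequality for \<open>exp\<close> is
      applied to the uniform choice of the first block.\<close>
    have per: "exp (- total_cost E w P) \<le> (\<Sum>B\<in>P. h B (P - {B})) / M" if P: "P \<in> configs E S i" for P
    proof -
      have fin: "finite P" using finite_mem_configs finS P by blast
      have cP: "M = 2 * real (card P)"
        using configs_card[OF finS P assms(2)] unfolding M_def by linarith
      have ne: "P \<noteq> {}" using cP M by auto
      have "- total_cost E w P = (\<Sum>B\<in>P. - total_cost E w (P - {B}) - ask_cost E w P B / 2) / real (card P)"
        unfolding total_cost_rec[OF fin ne] step_cost_def
        using fin ne by (simp add: sum_subtractf sum_negf sum_divide_distrib[symmetric] field_simps)
          (simp add: sum_distrib_left)
      also have "exp \<dots> \<le> (\<Sum>B\<in>P. exp (- total_cost E w (P - {B}) - ask_cost E w P B / 2)) / real (card P)"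
        by (rule exp_avg_le[OF fin ne])
      also have "\<dots> \<le> (\<Sum>B\<in>P. h B (P - {B}) / 2) / real (card P)"
      proof (intro divide_right_mono sum_mono)
        fix B assume B: "B \<in> P"
        have "exp (- total_cost E w (P - {B}) - ask_cost E w P B / 2)
          = exp (- total_cost E w (P - {B})) * exp (- ask_cost E w P B / 2)"
          by (simp flip: exp_add)
        also have "\<dots> \<le> exp (- total_cost E w (P - {B})) * (r B / 2)"
          by (intro mult_left_mono block[OF P B]) auto
        finally show "exp (- total_cost E w (P - {B}) - ask_cost E w P B / 2) \<le> h B (P - {B}) / 2"
          by (simp add: h_def)
      qed auto
      also have "\<dots> = (\<Sum>B\<in>P. h B (P - {B})) / M"
        by (simp add: cP flip: sum_divide_distrib)
      finally show ?thesis .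
    qed
    have IH: "fact j * (\<Sum>P\<in>configs E (S - B) j. exp (- total_cost E w P)) \<le> 1"
      if "B \<subseteq> S" "B \<noteq> {}" for B j
    proof -
      have "S - B \<subset> S" using that by auto
      then show ?thesis using less.hyps[of "S - B" j] finS by (simp add: psubset_card_mono)
    qed
    \<comment> \<open>The induction hypothesis bounds the sum over the remaining configuration by 1;
      what is left is counted endpoint by endpoint.\<close>
    have edges: "fact i * (\<Sum>B | B \<in> E \<and> B \<subseteq> S. \<Sum>P\<in>configs E (S - B) i. h B P)
        \<le> (\<Sum>v\<in>S. real (card {u\<in>S. {v, u} \<in> E}) / D v)"
    proof -
      have "fact i * (\<Sum>B | B \<in> E \<and> B \<subseteq> S. \<Sum>P\<in>configs E (S - B) i. h B P)
          = (\<Sum>B | B \<in> E \<and> B \<subseteq> S. (fact i * (\<Sum>P\<in>configs E (S - B) i. exp (- total_cost E w P))) * r B)"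
        by (simp add: h_def sum_distrib_left sum_distrib_right mult.assoc)
      also have "\<dots> \<le> (\<Sum>B | B \<in> E \<and> B \<subseteq> S. 1 * r B)"
      proof (intro sum_mono mult_right_mono r0)
        fix B assume B: "B \<in> {B. B \<in> E \<and> B \<subseteq> S}"
        then have "card B = 2" using assms(2) by simp
        then have "B \<noteq> {}" by auto
        with B show "fact i * (\<Sum>P\<in>configs E (S - B) i. exp (- total_cost E w P)) \<le> 1"
          by (intro IH) simp_all
      qed
      also have "\<dots> = (\<Sum>B | B \<in> E \<and> B \<subseteq> S. \<Sum>v | v \<in> S \<and> v \<in> B. 1 / D v)"
      proof (intro sum.cong refl)
        fix B assume B: "B \<in> {B. B \<in> E \<and> B \<subseteq> S}"
        then have "{v. v \<in> S \<and> v \<in> B} = B" "card B = 2" using assms(2) by auto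
        then show "1 * r B = (\<Sum>v | v \<in> S \<and> v \<in> B. 1 / D v)" by (simp add: r_def)
      qed
      also have "\<dots> = (\<Sum>v\<in>S. \<Sum>B | B \<in> {B. B \<in> E \<and> B \<subseteq> S} \<and> v \<in> B. 1 / D v)"
        using finS by (intro sum.swap_restrict finite_subset_Collect) auto
      also have "\<dots> = (\<Sum>v\<in>S. real (card {u\<in>S. {v, u} \<in> E}) / D v)"
      proof (intro sum.cong refl)
        fix v assume v: "v \<in> S"
        show "(\<Sum>B | B \<in> {B. B \<in> E \<and> B \<subseteq> S} \<and> v \<in> B. 1 / D v) = real (card {u\<in>S. {v, u} \<in> E}) / D v"
          by (simp add: card_neighbours_eq[OF assms(2) v])
      qed
      finally show ?thesis .
    qed
    \<comment> \<open>A singleton uses up one dummy: \<open>fact i = i * fact (i - 1)\<close> leaves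
      a factor i for the choice of that dummy.\<close>
    have singles: "fact i * (\<Sum>v\<in>S. if i = 0 then 0 else \<Sum>P\<in>configs E (S - {v}) (i - 1). h {v} P)
        \<le> (\<Sum>v\<in>S. real i * (w / D v + 1 / real (card S)))"
      unfolding sum_distrib_left
    proof (intro sum_mono)
      fix v assume v: "v \<in> S"
      have r: "r {v} = w / D v + 1 / real (card S)" by (simp add: r_def)
      show "fact i * (if i = 0 then 0 else \<Sum>P\<in>configs E (S - {v}) (i - 1). h {v} P)
        \<le> real i * (w / D v + 1 / real (card S))"
      proof (cases "i = 0")
        case False
        then have fi: "fact i = real i * fact (i - 1)" by (simp add: fact_reduce)
        have "fact i * (\<Sum>P\<in>configs E (S - {v}) (i - 1). h {v} P)
           = real i * ((fact (i - 1) * (\<Sum>P\<in>configs E (S - {v}) (i - 1). exp (- total_cost E w P))) * r {v})"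
          unfolding fi by (simp add: h_def sum_distrib_left sum_distrib_right mult.assoc)
        also have "\<dots> \<le> real i * (1 * r {v})"
          using IH[of "{v}"] v r0 by (intro mult_left_mono mult_right_mono) auto
        finally show ?thesis using False r by simp
      qed simp
    qed
    have "fact i * (\<Sum>P\<in>configs E S i. exp (- total_cost E w P))
        \<le> fact i * (\<Sum>P\<in>configs E S i. (\<Sum>B\<in>P. h B (P - {B})) / M)"
      by (intro mult_left_mono sum_mono per) auto
    also have "\<dots> = fact i * (\<Sum>P\<in>configs E S i. \<Sum>B\<in>P. h B (P - {B})) / M"
      by (simp flip: sum_divide_distrib)
    also have "\<dots> \<le> fact i * ((\<Sum>B | B \<in> E \<and> B \<subseteq> S. \<Sum>P\<in>configs E (S - B) i. h B P)
      + (\<Sum>v\<in>S. if i = 0 then 0 else \<Sum>P\<in>configs E (S - {v}) (i - 1). h {v} P)) / M"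
      using M r0 by (intro divide_right_mono mult_left_mono sum_configs_blocks_le[OF finS assms(2)])
        (auto simp: h_def)
    also have "\<dots> \<le> ((\<Sum>v\<in>S. real (card {u\<in>S. {v, u} \<in> E}) / D v)
        + (\<Sum>v\<in>S. real i * (w / D v + 1 / real (card S)))) / M"
      using edges singles M by (intro divide_right_mono) (auto simp: distrib_left)
    also have "\<dots> = ((\<Sum>v\<in>S. D v / D v) + real i) / M"
    proof -
      have "(\<Sum>v\<in>S. real (card {u\<in>S. {v, u} \<in> E}) / D v) + (\<Sum>v\<in>S. real i * (w / D v + 1 / real (card S)))
          = (\<Sum>v\<in>S. D v / D v + real i / real (card S))"
        unfolding sum.distrib[symmetric]
      proof (intro sum.cong refl)
        fix v
        have "real (card {u\<in>S. {v, u} \<in> E}) / D v + real i * (w / D v + 1 / real (card S))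
          = (real (card {u\<in>S. {v, u} \<in> E}) + w * real i) / D v + real i / real (card S)"
          by (simp add: add_divide_distrib distrib_left mult.commute)
        then show "real (card {u\<in>S. {v, u} \<in> E}) / D v + real i * (w / D v + 1 / real (card S))
          = D v / D v + real i / real (card S)"
          by (simp only: D_def)
      qed
      also have "\<dots> = (\<Sum>v\<in>S. D v / D v) + real i" using cS by (simp add: sum.distrib)
      finally show ?thesis by simp
    qed
    \<comment> \<open>\<open>D v / D v\<close> is 0 instead of 1 when v has no possible guess, hence
      only an inequality.\<close>
    also have "\<dots> \<le> ((\<Sum>v\<in>S. 1) + real i) / M"
      using M by (intro divide_right_mono add_right_mono sum_mono) (auto simp: divide_simps)
    also have "\<dots> = 1" using M by (simp add: M_def)
    finally show ?thesis .
  qed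
qed

subsection \<open>The expected code length\<close>

text \<open>The edge containing v offers it exactly one partner: \<open>{v, v}\<close> has one
  element and so is not an edge.\<close>

lemma avail_edge:
  assumes "\<And>e. e \<in> E \<Longrightarrow> card e = 2" "B \<in> E" "v \<in> B"
  shows "avail E w v B = 1"
proof -
  have B: "card B = 2" using assms by simp
  then obtain a b where "B = {a, b}" "a \<noteq> b" unfolding card_2_iff by blast
  with assms(3) obtain u where u: "B = {v, u}" "u \<noteq> v" by blast
  have "{v, v} \<notin> E" using assms(1)[of "{v, v}"] by auto
  then have "{u'\<in>B. {v, u'} \<in> E} = {u}" using u assms(2) by auto
  then show ?thesis using B by (simp add: avail_def)
qed

lemma avail_single:
  assumes "\<And>e. e \<in> E \<Longrightarrow> card e = 2"
  shows "avail E w v {v} = w"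
proof -
  have "{v, v} \<notin> E" using assms[of "{v, v}"] by auto
  then have "{u\<in>{v}. {v, u} \<in> E} = {}" by auto
  then show ?thesis by (simp add: avail_def)
qed

text \<open>
  Given a block, the other \<open>k\<close> hidden blocks are a uniform \<open>k\<close>-subset, so each vertex outside the
  block is hidden with probability \<open>q\<close>, whatever the configuration. The weight \<open>w\<close> is tuned
  (\<open>d + w m = w N\<close>) so that vertex guesses and dummy guesses of singletons cost the same.
\<close>

lemma ask_cost_avg_le:
  fixes E :: "'a set set" and V :: "'a set"
  assumes finV: "finite V" and E: "\<And>e. e \<in> E \<Longrightarrow> card e = 2" and "0 < w"
    and deg: "\<And>v. v \<in> V \<Longrightarrow> card {u\<in>V. {v, u} \<in> E} = d"
    and P: "P \<in> configs E V m" and B: "B \<in> P"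
    and x: "real d + w * real m = x" "w * real (card V) = x" and x1: "1 \<le> x"
    and n: "k < card P"
    and q: "q = real k / real (card P - 1)"
  shows "subset_avg k (P - {B}) (\<lambda>Q. ask_cost E w (insert B Q) B)
    \<le> 2 * (if card B = 1 then ln (1 + q * (real (card V) - 1)) else ln (1 + q * (x - 1)))"
proof -
  have finP: "finite P" using finite_mem_configs finV P by blast
  have fin: "finite (P - {B})" and cP: "card (P - {B}) = card P - 1"
    using finP B by auto
  have k: "k \<le> card (P - {B})" using n cP by simp
  have Bfacts: "card B = 1 \<or> (B \<in> E \<and> card B = 2)" "B \<subseteq> V" "finite B"
    using configs_block[OF P B E] by auto
  have q0: "0 \<le> q" using q by simp
  have cV: "1 \<le> card V" using Bfacts finV configs_block[OF P B E] by (metis One_nat_def Suc_leI card_gt_0_iff subset_empty)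
  have rest: "(\<Sum>B'\<in>P - {B}. f B') = (\<Sum>B'\<in>P. f B') - f B" for f :: "'a set \<Rightarrow> real"
    using sum.remove[OF finP B, of f] by simp
  have ins: "(\<Sum>B'\<in>insert B Q. f B') = f B + (\<Sum>B'\<in>Q. f B')" if "Q \<subseteq> P - {B}" for Q and f :: "'a set \<Rightarrow> real"
    using that finite_subset[OF that fin] by (subst sum.insert) auto
  \<comment> \<open>B is certainly hidden and counts in full; the other blocks carry the remaining
    weight, each hidden with probability q. If B is the only block, then k = 0 and q = 0 / 0 =
    0.\<close>
  have avail_le: "subset_avg k (P - {B}) (\<lambda>Q. ln (\<Sum>B'\<in>insert B Q. avail E w v B'))
      \<le> ln (avail E w v B + q * (x - avail E w v B))"
    if v: "v \<in> B" and pos: "0 < avail E w v B" for v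
  proof -
    have "(\<Sum>B'\<in>P. avail E w v B') = x"
      using configs_sum_avail[OF finV P, of w v] deg[of v] v Bfacts x by auto
    moreover have "0 \<le> avail E w v B'" for B' using \<open>0 < w\<close> by (simp add: avail_def)
    moreover have "subset_avg k (P - {B}) (\<lambda>Q. ln (\<Sum>B'\<in>insert B Q. avail E w v B'))
        = subset_avg k (P - {B}) (\<lambda>Q. ln (avail E w v B + (\<Sum>B'\<in>Q. avail E w v B')))"
      by (rule subset_avg_cong) (simp only: ins)
    ultimately show ?thesis
      using subset_avg_ln_sum_le[OF fin k pos, of "avail E w v"] cP q by (simp add: rest)
  qed
  show ?thesis
  proof (cases "card B = 1")
    case True
    then obtain v where v: "B = {v}" by (auto simp: card_1_singleton_iff)
    have pos: "0 < 1 + q * (real (card V) - 1)"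
      using q0 cV by (intro add_pos_nonneg mult_nonneg_nonneg) auto
    \<comment> \<open>Since \<open>w * card V = x\<close>, the factor w splits off; its logarithm
      then cancels against the \<open>- ln w\<close> in \<open>ask_cost\<close>.\<close>
    have "w + q * (x - w) = w * (1 + q * (real (card V) - 1))"
      using x(2) by (simp add: algebra_simps)
    then have "ln (w + q * (x - w)) = ln w + ln (1 + q * (real (card V) - 1))"
      using \<open>0 < w\<close> pos by (simp add: ln_mult_pos)
    then have 1: "subset_avg k (P - {B}) (\<lambda>Q. ln (\<Sum>B'\<in>insert B Q. avail E w v B'))
        \<le> ln w + ln (1 + q * (real (card V) - 1))"
      using avail_le[of v] v avail_single[OF E, where w = w and v = v] \<open>0 < w\<close> by simp
    have 2: "subset_avg k (P - {B}) (\<lambda>Q. ln (\<Sum>B'\<in>insert B Q. real (card B')))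
        \<le> ln (1 + q * (real (card V) - 1))"
    proof -
      have "subset_avg k (P - {B}) (\<lambda>Q. ln (\<Sum>B'\<in>insert B Q. real (card B')))
          = subset_avg k (P - {B}) (\<lambda>Q. ln (1 + (\<Sum>B'\<in>Q. real (card B'))))"
        by (rule subset_avg_cong) (simp only: ins True of_nat_1)
      then show ?thesis
        using subset_avg_ln_sum_le[OF fin k, of 1 "\<lambda>B'. real (card B')"] cP q
          rest[of "\<lambda>B'. real (card B')"] configs_sum_card[OF finV P] True by simp
    qed
    have "subset_avg k (P - {B}) (\<lambda>Q. ask_cost E w (insert B Q) B)
      = subset_avg k (P - {B}) (\<lambda>Q. ln (\<Sum>B'\<in>insert B Q. avail E w v B')
          + (ln (\<Sum>B'\<in>insert B Q. real (card B')) + - ln w))"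
      using v by (intro subset_avg_cong) (simp add: ask_cost_def)
    also have "\<dots> = subset_avg k (P - {B}) (\<lambda>Q. ln (\<Sum>B'\<in>insert B Q. avail E w v B'))
          + (subset_avg k (P - {B}) (\<lambda>Q. ln (\<Sum>B'\<in>insert B Q. real (card B'))) + - ln w)"
      unfolding subset_avg_add subset_avg_const[OF fin k] ..
    finally show ?thesis using 1 2 True by simp
  next
    case False
    then have BE: "B \<in> E" "card B = 2" using Bfacts by auto
    have "subset_avg k (P - {B}) (\<lambda>Q. ask_cost E w (insert B Q) B)
      = (\<Sum>v\<in>B. subset_avg k (P - {B}) (\<lambda>Q. ln (\<Sum>B'\<in>insert B Q. avail E w v B')))"
      using False by (simp add: ask_cost_def subset_avg_sum)
    also have "\<dots> \<le> (\<Sum>v\<in>B. ln (1 + q * (x - 1)))"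
    proof (rule sum_mono)
      fix v assume v: "v \<in> B"
      show "subset_avg k (P - {B}) (\<lambda>Q. ln (\<Sum>B'\<in>insert B Q. avail E w v B')) \<le> ln (1 + q * (x - 1))"
        using avail_le[OF v] avail_edge[OF E BE(1) v, of w] by simp
    qed
    finally show ?thesis using False BE by simp
  qed
qed

text \<open>Over the stages the hiding probabilities k / (p - 1) are equally spaced in [0, 1], so
  the stage costs add up to a sampled integral. Each of the l edges pays with parameter x, each of
  the m singletons with \<open>card V\<close>.\<close>

lemma total_cost_le:
  fixes E :: "'a set set" and V :: "'a set"
  assumes finV: "finite V" and E: "\<And>e. e \<in> E \<Longrightarrow> card e = 2" and "0 < w"
    and deg: "\<And>v. v \<in> V \<Longrightarrow> card {u\<in>V. {v, u} \<in> E} = d"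
    and P: "P \<in> configs E V m" and l: "card P = l + m" and ne: "V \<noteq> {}"
    and x: "real d + w * real m = x" "w * real (card V) = x" and x1: "1 \<le> x"
  shows "total_cost E w P \<le> real l * (ln x - 1 + ln_ratio x)
    + real m * (ln (real (card V)) - 1 + ln_ratio (real (card V)))"
proof -
  define p where "p = card P"
  define N where "N = real (card V)"
  have finP: "finite P" using finite_mem_configs finV P by blast
  have N1: "1 \<le> N" using ne finV by (simp add: N_def Suc_leI card_gt_0_iff)
  have p1: "1 \<le> p"
    using configs_card[OF finV P E] N1 unfolding N_def p_def by linarith
  define J where "J k = real l * ln (1 + real k / real (p - 1) * (x - 1))
      + real m * ln (1 + real k / real (p - 1) * (N - 1))" for k
  have stage: "subset_avg (Suc k) P (step_cost E w) \<le> J k / real p" if k: "k < p" for k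
  proof -
    let ?g = "\<lambda>B. if card B = 1 then ln (1 + real k / real (p - 1) * (N - 1))
       else ln (1 + real k / real (p - 1) * (x - 1))"
    have "subset_avg (Suc k) P (step_cost E w)
        = subset_avg (Suc k) P (\<lambda>Q. (\<Sum>B\<in>Q. ask_cost E w Q B) / (2 * real (Suc k)))"
      by (rule subset_avg_cong) (simp only: step_cost_def)
    \<comment> \<open>A block is still hidden with probability \<open>Suc k / p\<close>; against the
      \<open>2 * Suc k\<close> askers this leaves 1 / (2 p), and the 2 is used up by the two askers
      of the block.\<close>
    also have "\<dots> = (real (Suc k) / real p * (\<Sum>B\<in>P. subset_avg k (P - {B}) (\<lambda>Q. ask_cost E w (insert B Q) B)))
        / (2 * real (Suc k))"
      using subset_avg_swap[OF finP, of "Suc k" "\<lambda>B Q. ask_cost E w Q B"] k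
      by (simp add: subset_avg_divide p_def)
    also have "\<dots> \<le> (real (Suc k) / real p * (\<Sum>B\<in>P. 2 * ?g B)) / (2 * real (Suc k))"
      unfolding N_def p_def using k
      by (intro divide_right_mono mult_left_mono sum_mono
          ask_cost_avg_le[OF finV E \<open>0 < w\<close> deg P _ x x1]) (auto simp: p_def)
    also have "\<dots> = (\<Sum>B\<in>P. ?g B) / real p"
    proof -
      have "(c / real p * (2 * s)) / (2 * c) = s / real p" if "c \<noteq> 0" for c s :: real
        using that by simp
      then show ?thesis by (simp only: sum_distrib_left[symmetric] of_nat_eq_0_iff)
    qed
    also have "(\<Sum>B\<in>P. ?g B) = J k"
    proof -
      have m: "card {B\<in>P. card B = 1} = m" using P by (simp add: configs_def)
      have "P \<inter> - {B. card B = 1} = P - {B\<in>P. card B = 1}" by auto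
      then have "card (P \<inter> - {B. card B = 1}) = l"
        using m l finP by (simp add: card_Diff_subset)
      moreover have "P \<inter> {B. card B = 1} = {B\<in>P. card B = 1}" by auto
      ultimately show ?thesis
        using m by (simp only: sum.If_cases[OF finP] sum_constant J_def)
    qed
    finally show ?thesis .
  qed
  have "total_cost E w P = (\<Sum>k<p. subset_avg (Suc k) P (step_cost E w))"
    by (simp add: total_cost_def p_def sum.atLeast1_atMost_eq)
  also have "\<dots> \<le> (\<Sum>k<p. J k / real p)"
    by (intro sum_mono stage) simp
  also have "\<dots> = (\<Sum>k<p. J k) / real p" by (simp add: sum_divide_distrib)
  also have "(\<Sum>k<p. J k) = real l * (\<Sum>k<p. ln (1 + real k / real (p - 1) * (x - 1)))
      + real m * (\<Sum>k<p. ln (1 + real k / real (p - 1) * (N - 1)))"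
    by (simp add: J_def sum.distrib sum_distrib_left)
  also have "\<dots> / real p \<le> (real l * (real p * (ln x - 1 + ln_ratio x))
      + real m * (real p * (ln N - 1 + ln_ratio N))) / real p"
    using p1 x1 N1 by (intro divide_right_mono add_mono mult_left_mono sum_ln_equispaced_le) auto
  also have "\<dots> = real l * (ln x - 1 + ln_ratio x) + real m * (ln N - 1 + ln_ratio N)"
    using p1 by (simp add: field_simps)
  finally show ?thesis by (simp add: N_def)
qed

text \<open>Adding the uncovered vertices as singletons is injective: edges have two elements, so
  the matching is recovered as the set of non-singleton blocks.\<close>

lemma card_matchings_le_configs:
  fixes E :: "'a set set" and V :: "'a set"
  assumes finV: "finite V" and E: "\<And>e. e \<in> E \<Longrightarrow> card e = 2" "\<And>e. e \<in> E \<Longrightarrow> e \<subseteq> V"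
  shows "num_matchings l E \<le> card (configs E V (card V - 2 * l))"
  unfolding num_matchings_def
proof (rule card_inj_on_le)
  let ?f = "\<lambda>M. M \<union> (\<lambda>v. {v}) ` (V - \<Union>M)"
  let ?A = "{M. is_matching E M \<and> card M = l}"
  have split: "{B\<in>?f M. card B = 1} = (\<lambda>v. {v}) ` (V - \<Union>M)" "{B\<in>?f M. card B \<noteq> 1} = M"
    if "M \<in> ?A" for M
  proof -
    have "card B = 2" if "B \<in> M" for B
      using E(1) that \<open>M \<in> ?A\<close> by (auto simp: is_matching_def)
    then show "{B\<in>?f M. card B = 1} = (\<lambda>v. {v}) ` (V - \<Union>M)" "{B\<in>?f M. card B \<noteq> 1} = M"
      by auto
  qed
  show "inj_on ?f ?A"
  proof (rule inj_onI)
    fix M M' assume "M \<in> ?A" "M' \<in> ?A" "?f M = ?f M'"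
    then show "M = M'" using split(2)[of M] split(2)[of M'] by simp
  qed
  show "finite (configs E V (card V - 2 * l))" by (rule finite_configs[OF finV])
  show "?f ` ?A \<subseteq> configs E V (card V - 2 * l)"
  proof (rule image_subsetI)
    fix M assume M: "M \<in> ?A"
    then have ME: "M \<subseteq> E" and disj: "pairwise disjnt M" and cM: "card M = l"
      by (auto simp: is_matching_def)
    have MV: "\<Union>M \<subseteq> V" using ME E(2) by blast
    have fM: "finite B" if "B \<in> M" for B
      using that MV finV by (meson Union_upper finite_subset)
    have "card (\<Union>M) = (\<Sum>B\<in>M. card B)"
      using disj fM by (intro card_Union_disjoint)
    also have "\<dots> = (\<Sum>B\<in>M. 2)" using ME E(1) by (intro sum.cong) auto
    finally have "card (\<Union>M) = 2 * l" using cM by simp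
    then have "card (V - \<Union>M) = card V - 2 * l"
      using MV finV by (simp add: card_Diff_subset finite_subset)
    then have "card {B\<in>?f M. card B = 1} = card V - 2 * l"
      unfolding split(1)[OF M] by (subst card_image) auto
    moreover have "\<Union>(?f M) = V" using MV by auto
    moreover have "pairwise disjnt (?f M)"
    proof (rule pairwiseI)
      fix B B' assume "B \<in> ?f M" "B' \<in> ?f M" "B \<noteq> B'"
      then show "disjnt B B'"
        using pairwiseD[OF disj, of B B'] by (auto simp: disjnt_def)
    qed
    moreover have "\<forall>B\<in>?f M. B \<in> E \<or> card B = 1" using ME by auto
    ultimately show "?f M \<in> configs E V (card V - 2 * l)" unfolding configs_def by blast
  qed
qed

text \<open>Every configuration costs at most the same \<open>T\<close>, so each term of Kraft's
  inequality is at least \<open>exp (- T)\<close>; hence \<open>fact m\<close> times the number of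
  matchings is at most \<open>exp T\<close>.\<close>

lemma ln_num_matchings_le:
  fixes V :: "'a set" and E :: "'a set set"
  assumes "regular_graph d V E" "1 \<le> d" "1 \<le> l" "2 * l \<le> card V" "0 < num_matchings l E"
    and m: "m = card V - 2 * l" and x: "x = real d * real (card V) / real (2 * l)"
  shows "ln (real (num_matchings l E)) \<le> real l * (ln x - 1 + ln_ratio x)
    + real m * (ln (real (card V)) - 1 + ln_ratio (real (card V))) - ln (fact m)"
proof -
  have finV: "finite V" and E: "\<And>e. e \<in> E \<Longrightarrow> card e = 2" "\<And>e. e \<in> E \<Longrightarrow> e \<subseteq> V"
    and degree: "\<And>v. v \<in> V \<Longrightarrow> degree E v = d"
    using assms(1) by (auto simp: regular_graph_def simple_graph_def)
  have deg: "card {u\<in>V. {v, u} \<in> E} = d" if "v \<in> V" for v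
  proof -
    have "{B. (B \<in> E \<and> B \<subseteq> V) \<and> v \<in> B} = {e\<in>E. v \<in> e}" using E(2) by auto
    then show ?thesis
      using card_neighbours_eq[OF E(1) that] degree[OF that] by (simp add: degree_def)
  qed
  \<comment> \<open>The solution of \<open>d + w * m = w * card V\<close>, because
    \<open>card V - m = 2 * l\<close>.\<close>
  define w where "w = real d / real (2 * l)"
  have w: "0 < w" using assms by (simp add: w_def)
  have V: "V \<noteq> {}" using assms by auto
  have x2: "w * real (card V) = x" by (simp add: x w_def)
  have mr: "real m = real (card V) - real (2 * l)" using m assms(4) by (simp add: of_nat_diff)
  have x1: "real d + w * real m = x"
    using assms(3) unfolding mr by (simp add: w_def x field_simps)
  have "real d * real (2 * l) \<le> real d * real (card V)" using assms(4) by (intro mult_left_mono) auto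
  then have "real d \<le> x" using assms(3) by (simp add: x field_simps)
  with assms(2) have x3: "1 \<le> x" by linarith
  define T where "T = real l * (ln x - 1 + ln_ratio x)
    + real m * (ln (real (card V)) - 1 + ln_ratio (real (card V)))"
  have "fact m * (real (num_matchings l E) * exp (- T)) \<le> fact m * (\<Sum>P\<in>configs E V m. exp (- T))"
    using card_matchings_le_configs[of V E l, OF finV E] m by simp
  also have "\<dots> \<le> fact m * (\<Sum>P\<in>configs E V m. exp (- total_cost E w P))"
  proof (intro mult_left_mono sum_mono)
    fix P assume P: "P \<in> configs E V m"
    have "card P = l + m" using configs_card[OF finV P E(1)] m assms(4) by linarith
    then have "total_cost E w P \<le> T"
      unfolding T_def using total_cost_le[OF finV E(1) w deg P _ V x1 x2 x3] by simp
    then show "exp (- T) \<le> exp (- total_cost E w P)" by simp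
  qed simp
  also have "\<dots> \<le> 1" by (rule kraft_configs[OF finV E(1) w])
  finally have "fact m * real (num_matchings l E) \<le> exp T"
    by (simp add: exp_minus field_simps)
  then have "ln (fact m * real (num_matchings l E)) \<le> T"
    using assms(5) ln_le_cancel_iff[of "fact m * real (num_matchings l E)" "exp T"] by simp
  then show ?thesis using assms(5) by (simp add: T_def ln_mult_pos)
qed

subsection \<open>Counting matchings\<close>

lemma num_matchings_0:
  assumes "finite E"
  shows "num_matchings 0 E = 1"
proof -
  have "{M. is_matching E M \<and> card M = 0} = {{}}"
    using assms by (auto simp: is_matching_def dest: finite_subset)
  then show ?thesis by (simp add: num_matchings_def)
qed

lemma degree_le_card:
  assumes "regular_graph d V E" "V \<noteq> {}"
  shows "d \<le> card V"
proof -
  obtain v where v: "v \<in> V" using assms(2) by blast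
  have fin: "finite V" and E: "\<And>e. e \<in> E \<Longrightarrow> card e = 2" "\<And>e. e \<in> E \<Longrightarrow> e \<subseteq> V"
    and degree: "degree E v = d"
    using assms v by (auto simp: regular_graph_def simple_graph_def)
  have "{B. (B \<in> E \<and> B \<subseteq> V) \<and> v \<in> B} = {e\<in>E. v \<in> e}" using E(2) by auto
  then have "d = card {u\<in>V. {v, u} \<in> E}"
    using card_neighbours_eq[OF E(1) v] degree by (simp add: degree_def)
  also have "\<dots> \<le> card V" using fin by (intro card_mono) auto
  finally show ?thesis .
qed

theorem theorem1p2:
  fixes V :: "'a set" and E :: "'a set set" and d N l :: nat and \<alpha> :: real
  assumes "d \<ge> 1"
    and "regular_graph d V E"
    and "card V = N" and "N \<ge> 1"
    and "2 * l \<le> N"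
    and "\<alpha> = 2 * real l / real N"
  shows "log2_count (num_matchings l E) \<le>
    ereal (real N / 2 *
      (\<alpha> * log 2 (real d) + 2 * binary_entropy \<alpha> + \<alpha> * log 2 (\<alpha> / exp 1)
        + log_ratio (real d)))"
proof -
  consider "num_matchings l E = 0" | "l = 0" | "0 < num_matchings l E" "1 \<le> l" by linarith
  then show ?thesis
  proof cases
    case 1
    then show ?thesis by (simp add: log2_count_def)
  next
    case 2
    \<comment> \<open>The count is 1 and the right side reduces to the \<open>log_ratio\<close>
      term. The case is separate because x below has l in its denominator.\<close>
    have "finite E"
      using assms(2) by (auto simp: regular_graph_def simple_graph_def intro: finite_subset[of _ "Pow V"])
    moreover have "0 \<le> log_ratio (real d)"
      using ln_ratio_nonneg[of "real d"] assms(1) by (simp add: log_ratio_eq)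
    ultimately show ?thesis
      using 2 assms(6) by (simp add: log2_count_def num_matchings_0 binary_entropy_def)
  next
    case 3
    have V: "V \<noteq> {}" using assms by auto
    define m where "m = N - 2 * l"
    define x where "x = real d * real N / real (2 * l)"
    define K where "K = real (num_matchings l E)"
    \<comment> \<open>The right side of the theorem multiplied by \<open>ln 2\<close>, with all
      logarithms natural.\<close>
    define T where "T = real N / 2 * (\<alpha> * ln (real d) + 2 * (- \<alpha> * ln \<alpha> - (1 - \<alpha>) * ln (1 - \<alpha>))
       + \<alpha> * (ln \<alpha> - 1) + ln_ratio (real d))"
    have N: "0 < real N" using assms by simp
    have \<alpha>: "0 < \<alpha>" using 3 assms by simp
    have mr: "real m = real N - 2 * real l" using m_def assms(5) by (simp add: of_nat_diff)
    have l\<alpha>: "real N * \<alpha> = 2 * real l" and m\<alpha>: "real N * (1 - \<alpha>) = real m"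
      using assms(6) N mr by (simp_all add: field_simps)
    have "x = real d / \<alpha>" using assms(6) by (simp add: x_def)
    then have lnx: "ln x = ln (real d) - ln \<alpha>" using \<alpha> assms(1) by (simp add: ln_div)
    have "real d * real (2 * l) \<le> real d * real N" using assms(5) by (intro mult_left_mono) auto
    then have dx: "real d \<le> x" using 3 by (simp add: x_def field_simps)
    have "ln_ratio x \<le> ln_ratio (real d)"
      using dx assms(1) by (intro ln_ratio_antimono) auto
    then have Rx: "real l * ln_ratio x \<le> real l * ln_ratio (real d)" by (rule mult_left_mono) simp
    have "d \<le> N" using degree_le_card[OF assms(2) V] assms(3) by simp
    then have RN: "ln_ratio (real N) \<le> ln_ratio (real d)"
      using assms(1) by (intro ln_ratio_antimono) auto
    have main: "ln K \<le> real l * (ln x - 1 + ln_ratio x)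
        + real m * (ln (real N) - 1 + ln_ratio (real N)) - ln (fact m)"
      unfolding K_def assms(3)[symmetric]
      by (rule ln_num_matchings_le[OF assms(2,1) 3(2)]) (use 3 assms in \<open>simp_all add: m_def x_def\<close>)
    \<comment> \<open>The lower bound for \<open>ln (fact m)\<close> exceeds
      \<open>m * ln m - m\<close> by half of \<open>1 + ln m\<close>, which pays for half of
      \<open>m * ln_ratio N\<close>; only \<open>m / 2\<close> copies remain.\<close>
    have slack: "real m * (ln (real N) - 1 + ln_ratio (real N)) - ln (fact m)
        \<le> real m / 2 * ln_ratio (real d) - real m * ln (1 - \<alpha>)"
    proof (cases "m = 0")
      case False
      then have m1: "1 \<le> m" by simp
      have "1 - \<alpha> = real m / real N" using m\<alpha> N by (simp add: field_simps)
      then have "ln (1 - \<alpha>) = ln (real m) - ln (real N)" using m1 N by (simp add: ln_div)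
      then have "real m * ln (1 - \<alpha>) = real m * ln (real m) - real m * ln (real N)"
        by (simp add: right_diff_distrib)
      moreover have "real m * ln_ratio (real N) \<le> 1 + ln (real m)"
        using m1 by (intro mult_ln_ratio_le) (auto simp: m_def)
      moreover have "real m / 2 * ln_ratio (real N) \<le> real m / 2 * ln_ratio (real d)"
        using RN by (intro mult_left_mono) auto
      ultimately show ?thesis
        using ln_fact_lower[OF m1] by (simp add: algebra_simps)
    qed simp
    have "T = (real N * \<alpha>) / 2 * (ln (real d) - ln \<alpha> - 1) - (real N * (1 - \<alpha>)) * ln (1 - \<alpha>)
        + real N / 2 * ln_ratio (real d)"
      by (simp add: T_def field_simps)
    \<comment> \<open>Edges and singletons together supply \<open>l + m / 2 = N / 2\<close> copies
      of \<open>ln_ratio d\<close>.\<close>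
    also have "\<dots> = real l * (ln x - 1) - real m * ln (1 - \<alpha>) + (real l + real m / 2) * ln_ratio (real d)"
      unfolding l\<alpha> m\<alpha> lnx mr by (simp add: field_simps)
    finally have "ln K \<le> T" using main slack Rx by (simp add: algebra_simps)
    then have "ln K / ln 2 \<le> T / ln 2" by (intro divide_right_mono) auto
    moreover have "T / ln 2 = real N / 2 *
      (\<alpha> * log 2 (real d) + 2 * binary_entropy \<alpha> + \<alpha> * log 2 (\<alpha> / exp 1) + log_ratio (real d))"
      using \<alpha> by (simp add: T_def log_def binary_entropy_def log_ratio_eq ln_div)
        (simp add: field_simps)
    ultimately show ?thesis
      using 3 by (simp add: log2_count_def log_def K_def)
  qed
qed

end
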